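(* Let $\ell \in \mathbb{N}$, let $\mathbf{n} = (n_1, \dots, n_\ell) \in \mathbb{N}^\ell$, and let $\varepsilon = 2^{-k}$ for some $k \in \mathbb{N}$. Then \[ \mu\big(R(\varepsilon, \mathbf{a}, \mathbf{n}) \cap [0, \operatorname{lcm}(\mathbf{n})]\big) \geq \mu\big(R(\varepsilon, \mathbf{0}, \mathbf{n}) \cap [0, \operatorname{lcm}(\mathbf{n})]\big) \] for all $\mathbf{a} \in \mathbb{R}^\ell$.
   Context: $\mathbb{N}$ denotes the positive integers and $\mu$ Lebesgue measure on $\mathbb{R}$. For $\mathbf{n} = (n_1,\dots,n_\ell) \in \mathbb{N}^\ell$, $\mathbf{a} = (a_1,\dots,a_\ell) \in \mathbb{R}^\ell$ and $\varepsilon > 0$, the real residue system is \[ R(\varepsilon, \mathbf{a}, \mathbf{n}) = \bigcup_{i=1}^{\ell} \big([a_i - \varepsilon, a_i + \varepsilon] + n_i \mathbb{Z}\big) \subset \mathbb{R}, \] and $\operatorname{lcm}(\mathbf{n}) = \operatorname{lcm}(n_1, \dots, n_\ell)$. *)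

theory Defs
  imports "HOL-Analysis.Analysis"
begin

(* A tuple of length l is a function on nat, of which only the values at 1, ..., l matter. *)

definition residue_system :: "nat \<Rightarrow> real \<Rightarrow> (nat \<Rightarrow> real) \<Rightarrow> (nat \<Rightarrow> nat) \<Rightarrow> real set" where
  "residue_system l \<epsilon> a n =
     (\<Union>i\<in>{1..l}. {x + real (n i) * of_int m | x m. x \<in> {a i - \<epsilon>..a i + \<epsilon>}})"

definition lcm_tuple :: "nat \<Rightarrow> (nat \<Rightarrow> nat) \<Rightarrow> nat" where
  "lcm_tuple l n = Lcm (n ` {1..l})"

end

theory Submission
  imports Defs
begin

text \<open>With \<open>m = 2 ^ (k - 1)\<close> the intervals have length \<open>1 / m\<close>, so along each coset of
  \<open>(1 / m) \<int>\<close> the system contains a union of residue classes modulo the \<open>m * n i\<close>. Rogers'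
  theorem says that such a union is smallest when all the classes contain \<open>0\<close>. To prove it, move
  the classes to \<open>0\<close> one prime at a time: for \<open>N = M * q\<close> with \<open>q\<close> a power of a prime not
  dividing \<open>M\<close>, replace the residues \<open>a i\<close> by \<open>e * a i\<close>, where \<open>e\<close> is \<open>1\<close> modulo \<open>M\<close> and
  \<open>0\<close> modulo \<open>q\<close>.\<close>

section \<open>Rogers' theorem for residue classes of integers\<close>

definition covered :: "'i set \<Rightarrow> ('i \<Rightarrow> int) \<Rightarrow> ('i \<Rightarrow> int) \<Rightarrow> int \<Rightarrow> int set" where
  "covered I n a N = {x \<in> {0..<N}. \<exists>i\<in>I. n i dvd x - a i}"

lemma finite_covered [simp]: "finite (covered I n a N)"
  by (rule finite_subset[of _ "{0..<N}"]) (auto simp: covered_def)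

text \<open>A divisor of \<open>M * q\<close> factors as \<open>b * c\<close> with
  \<open>b dvd M\<close> and \<open>c dvd q\<close>, so \<open>n\<close> divides the product of its
  two gcds, which are coprime. A class modulo \<open>n\<close> thus becomes one condition modulo
  \<open>M\<close> and one modulo \<open>q\<close>.\<close>

lemma dvd_iff_gcd_dvd_coprime:
  fixes n M q y :: int
  assumes "n dvd M * q" "coprime M q"
  shows "n dvd y \<longleftrightarrow> gcd n M dvd y \<and> gcd n q dvd y"
proof
  assume "gcd n M dvd y \<and> gcd n q dvd y"
  moreover have "coprime (gcd n M) (gcd n q)"
    using assms(2) by (meson coprime_divisors gcd_dvd2)
  ultimately have "gcd n M * gcd n q dvd y"
    by (simp add: divides_mult)
  moreover obtain b c where "n = b * c" "b dvd M" "c dvd q"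
    using division_decomp[OF assms(1)] by blast
  then have "n dvd gcd n M * gcd n q"
    by (metis dvd_triv_left dvd_triv_right gcd_greatest mult_dvd_mono)
  ultimately show "n dvd y" using dvd_trans by blast
qed (meson dvd_trans gcd_dvd1)

text \<open>On a class modulo \<open>M\<close> the surviving sets are cosets of subgroups of a cyclic group of
  prime power order \<open>q\<close>. These subgroups form a chain, so translated to the origin their union
  is just the largest of them, of which the original union still contains a translate.\<close>
lemma card_covered_idempotent_le:
  fixes n a :: "'i \<Rightarrow> int" and M p e :: int
  assumes I: "finite I" and p: "prime p" and cop: "coprime M (p ^ v)"
    and N: "M * p ^ v > 0" and n: "\<And>i. i \<in> I \<Longrightarrow> n i dvd M * p ^ v"
    and e: "p ^ v dvd e" "M dvd 1 - e"
  shows "card (covered I n (\<lambda>i. e * a i) (M * p ^ v)) \<le> card (covered I n a (M * p ^ v))"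
proof -
  define q where "q = p ^ v"
  define N where "N = M * q"
  \<comment> \<open>These are the classes not already excluded modulo \<open>M\<close> on the
    integers congruent to \<open>u\<close>. They are the same for \<open>a\<close> and
    \<open>e * a\<close>, as \<open>e\<close> is 1 modulo \<open>M\<close>.\<close>
  define J where "J u = {i \<in> I. gcd (n i) M dvd u - a i}" for u
  \<comment> \<open>The smallest gcd with \<open>q\<close> means the largest subgroup. For empty
    \<open>J u\<close> the choice is arbitrary and harmless: the translated system covers no point
    of that class.\<close>
  define i0 where "i0 u = arg_min_on (\<lambda>i. nat (gcd (n i) q)) (J u)" for u
  \<comment> \<open>Modulo \<open>M\<close> this shift is 0; modulo \<open>q\<close> it is
    \<open>a (i0 u)\<close>, so it carries the largest subgroup to its translate in the original
    system.\<close>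
  define s where "s u = (1 - e) * a (i0 u)" for u
  define F where "F x = (x + s (x mod M)) mod N" for x
  have Npos: "N > 0" and MN: "M dvd N"
    using N by (auto simp: N_def q_def)
  have split: "n i dvd y \<longleftrightarrow> gcd (n i) M dvd y \<and> gcd (n i) q dvd y" if "i \<in> I" for i y
    using dvd_iff_gcd_dvd_coprime n[OF that] cop unfolding q_def by blast
  have sM: "M dvd s u" for u using e(2) by (simp add: s_def)
  have JM: "J (x mod M) = J x" for x
  proof -
    have "gcd (n i) M dvd x mod M - a i \<longleftrightarrow> gcd (n i) M dvd x - a i" for i
    proof -
      have "x - a i = (x mod M - a i) + M * (x div M)"
        by (simp add: algebra_simps)
      then show ?thesis by (metis dvd_add_left_iff dvd_mult2 gcd_dvd2)
    qed
    then show ?thesis unfolding J_def by simp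
  qed
  have i0: "i0 u \<in> J u \<and> (\<forall>i\<in>J u. gcd (n (i0 u)) q dvd gcd (n i) q)" if "J u \<noteq> {}" for u
  proof -
    have fin: "finite (J u)" using I by (simp add: J_def)
    have in_J: "i0 u \<in> J u" unfolding i0_def by (rule arg_min_if_finite(1)[OF fin that])
    have "gcd (n (i0 u)) q dvd gcd (n i) q" if "i \<in> J u" for i
    proof -
      have le: "gcd (n (i0 u)) q \<le> gcd (n i) q"
        using arg_min_least[OF fin \<open>J u \<noteq> {}\<close> that, of "\<lambda>i. nat (gcd (n i) q)"]
        by (simp add: i0_def[symmetric] nat_le_eq_zle)
      \<comment> \<open>Both gcds divide \<open>q\<close>, hence are powers of \<open>p\<close>, and
        the order between them becomes divisibility.\<close>
      have pp: "\<exists>k. gcd (n j) q = p ^ k" for j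
        using divides_primepow[OF p, of "gcd (n j) q" v] by (auto simp: q_def)
      obtain k1 k2 where k: "gcd (n (i0 u)) q = p ^ k1" "gcd (n i) q = p ^ k2"
        using pp by metis
      have "p > 1" using p by (simp add: prime_gt_1_int)
      then show ?thesis using le unfolding k by (simp add: le_imp_power_dvd)
    qed
    with in_J show ?thesis by blast
  qed
  have Fmod: "F x mod M = x mod M" for x
    using sM[of "x mod M"] MN unfolding F_def
    by (metis dvd_imp_mod_0 mod_add_right_eq mod_mod_cancel add_0_right)
  \<comment> \<open>\<open>F\<close> maps every class modulo \<open>M\<close> to itself and acts
    there as a single translation modulo \<open>N\<close>.\<close>
  have "inj_on F {0..<N}"
  proof (rule inj_onI)
    fix x y assume xy: "x \<in> {0..<N}" "y \<in> {0..<N}" "F x = F y"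
    then have "x mod M = y mod M" by (metis Fmod)
    with xy(3) have "(x + s (x mod M)) mod N = (y + s (x mod M)) mod N"
      by (simp add: F_def)
    then have "x mod N = y mod N" by (metis add_diff_cancel_right' mod_diff_left_eq)
    with xy show "x = y" by simp
  qed
  moreover have "F ` covered I n (\<lambda>i. e * a i) N \<subseteq> covered I n a N"
  proof
    fix y assume "y \<in> F ` covered I n (\<lambda>i. e * a i) N"
    then obtain x i where x: "y = F x" "i \<in> I" "n i dvd x - e * a i"
      unfolding covered_def by blast
    have ge: "gcd (n i) M dvd x - e * a i" and hx: "gcd (n i) q dvd x - e * a i"
      using split[OF x(2)] x(3) by blast+
    have "gcd (n i) M dvd (1 - e) * a i" using e(2) by (meson dvd_mult2 dvd_trans gcd_dvd2)
    from dvd_diff[OF ge this] have "gcd (n i) M dvd x - a i" by (simp add: algebra_simps)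
    then have iJ: "i \<in> J x" using x(2) by (simp add: J_def)
    define j where "j = i0 (x mod M)"
    have j: "j \<in> J x" "gcd (n j) q dvd gcd (n i) q"
      using i0[of "x mod M"] iJ unfolding JM j_def by blast+
    then have jI: "j \<in> I" by (simp add: J_def)
    \<comment> \<open>As \<open>q\<close> divides \<open>e\<close>, the term \<open>e * a i\<close>
      vanishes modulo the \<open>q\<close>-part, so \<open>x\<close> lies in the subgroup of
      \<open>i\<close> and hence in the larger one of \<open>j\<close>.\<close>
    have qe: "gcd (n i') q dvd e * z" for i' z
      using e(1) unfolding q_def by (meson dvd_mult2 dvd_trans gcd_dvd2)
    have "gcd (n i) q dvd x" using dvd_add[OF hx qe[of i "a i"]] by simp
    then have "gcd (n j) q dvd x" using j(2) dvd_trans by blast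
    then have "gcd (n j) q dvd x - e * a j" using qe by simp
    then have 1: "gcd (n j) q dvd x + s (x mod M) - a j"
      by (simp add: s_def j_def algebra_simps)
    have "gcd (n j) M dvd x - a j" using j(1) by (simp add: J_def)
    from dvd_add[OF this dvd_trans[OF gcd_dvd2 sM[of "x mod M"]]]
    have 2: "gcd (n j) M dvd x + s (x mod M) - a j" by (simp add: algebra_simps)
    have 3: "n j dvd x + s (x mod M) - a j" using 1 2 split[OF jI] by blast
    have nN: "n j dvd N" using n[OF jI] by (simp add: N_def q_def)
    have "F x - a j = (x + s (x mod M) - a j) - N * ((x + s (x mod M)) div N)"
      unfolding F_def by (simp add: minus_mult_div_eq_mod[symmetric])
    then have "n j dvd F x - a j" using 3 nN by (metis dvd_diff dvd_mult2)
    moreover have "F x \<in> {0..<N}" using Npos by (simp add: F_def)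
    ultimately show "y \<in> covered I n a N" using jI x(1) unfolding covered_def by blast
  qed
  moreover have "covered I n (\<lambda>i. e * a i) N \<subseteq> {0..<N}" by (auto simp: covered_def)
  ultimately show ?thesis
    unfolding N_def[symmetric] q_def[symmetric]
    by (metis card_inj_on_le finite_covered inj_on_subset)
qed

text \<open>The multipliers for single primes are multiplied together: a new factor keeps the
  divisibility already gained, and the inequalities chain.\<close>

lemma exists_multiplier_card_covered_le:
  fixes n a :: "'i \<Rightarrow> int" and N :: int
  assumes "finite I" "N > 0" "\<And>i. i \<in> I \<Longrightarrow> n i dvd N" "finite S" "\<And>p. p \<in> S \<Longrightarrow> prime p"
  shows "\<exists>E. (\<forall>p\<in>S. p ^ multiplicity p N dvd E) \<and>
             card (covered I n (\<lambda>i. E * a i) N) \<le> card (covered I n a N)"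
  using assms(4,5)
proof (induction S)
  case empty
  show ?case by (intro exI[of _ 1]) simp
next
  case (insert p S)
  obtain E where E: "\<forall>p\<in>S. p ^ multiplicity p N dvd E"
    "card (covered I n (\<lambda>i. E * a i) N) \<le> card (covered I n a N)"
    using insert by blast
  define v where "v = multiplicity p N"
  have p: "prime p" using insert.prems by simp
  obtain M where M: "N = p ^ v * M" "\<not> p dvd M"
    unfolding v_def
  proof (rule multiplicity_decompose'[of N p])
    show "N \<noteq> 0" using assms(2) by simp
    show "\<not> is_unit p" using p not_prime_unit by blast
  qed
  have cop: "coprime M (p ^ v)"
    using prime_imp_coprime[OF p M(2)] by (simp add: coprime_commute)
  \<comment> \<open>Bezout's identity yields the idempotent: \<open>w * p ^ v\<close> is 0 modulo
    \<open>p ^ v\<close> and 1 modulo \<open>M\<close>.\<close>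
  obtain u w where uw: "u * M + w * p ^ v = 1"
    using cop bezout_int[of M "p ^ v"] by auto
  define e where "e = w * p ^ v"
  have "1 - e = M * u" using uw by (simp add: e_def mult.commute)
  then have e: "p ^ v dvd e" "M dvd 1 - e" by (simp_all add: e_def)
  have N: "N = M * p ^ v" using M(1) by (simp add: mult.commute)
  have "card (covered I n (\<lambda>i. e * (E * a i)) N) \<le> card (covered I n (\<lambda>i. E * a i) N)"
    unfolding N by (rule card_covered_idempotent_le) (use assms p cop e N in auto)
  with E e(1) show ?case
    by (intro exI[of _ "e * E"]) (auto simp: v_def mult.assoc)
qed

text \<open>Once all prime factors of \<open>N\<close> are treated, the multiplier is divisible by
  \<open>N\<close> and so by every \<open>n i\<close>, and all residues have become 0.\<close>

theorem rogers_card_covered: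
  fixes n a :: "'i \<Rightarrow> int" and N :: int
  assumes "finite I" "N > 0" "\<And>i. i \<in> I \<Longrightarrow> n i dvd N"
  shows "card (covered I n (\<lambda>_. 0) N) \<le> card (covered I n a N)"
proof -
  obtain E where E: "\<forall>p\<in>prime_factors N. p ^ multiplicity p N dvd E"
    and le: "card (covered I n (\<lambda>i. E * a i) N) \<le> card (covered I n a N)"
    using exists_multiplier_card_covered_le[of I N n "prime_factors N" a] assms by auto
  have "N dvd E"
  proof (cases "E = 0")
    case False
    show ?thesis
    proof (rule multiplicity_le_imp_dvd)
      fix p :: int assume p: "prime p"
      show "multiplicity p N \<le> multiplicity p E"
      proof (cases "p \<in> prime_factors N")
        case True
        then show ?thesis using E False p
          by (meson multiplicity_geI not_prime_unit)
      next
        case False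
        then have "\<not> p dvd N" using p assms(2) by (simp add: prime_factors_dvd)
        then show ?thesis by (simp add: not_dvd_imp_multiplicity_0)
      qed
    qed (use assms in auto)
  qed simp
  then have "n i dvd E * a i" if "i \<in> I" for i
    using assms(3)[OF that] by (meson dvd_mult2 dvd_trans)
  then have "covered I n (\<lambda>i. E * a i) N = covered I n (\<lambda>_. 0) N"
    unfolding covered_def by (auto simp: dvd_diff_left_iff dvd_diff_right_iff)
  with le show ?thesis by simp
qed

section \<open>From integer residue classes to the measure of interval systems\<close>

lemma residue_system_eq_UN:
  "residue_system l \<epsilon> a n =
     (\<Union>i\<in>{1..l}. \<Union>z::int. {a i + real (n i) * z - \<epsilon>..a i + real (n i) * z + \<epsilon>})"
  unfolding residue_system_def
proof (intro arg_cong[where f = "\<lambda>f. \<Union> (f ` {1..l})"] ext)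
  fix i
  have "\<exists>x. y = x + real (n i) * z \<and> x \<in> {a i - \<epsilon>..a i + \<epsilon>}"
    if "y \<in> {a i + real (n i) * z - \<epsilon>..a i + real (n i) * z + \<epsilon>}" for y and z :: int
    using that by (intro exI[of _ "y - real (n i) * z"]) auto
  moreover have "x + real (n i) * z \<in> {a i + real (n i) * z - \<epsilon>..a i + real (n i) * z + \<epsilon>}"
    if "x \<in> {a i - \<epsilon>..a i + \<epsilon>}" for x and z :: int
    using that by auto
  ultimately show "{x + real (n i) * of_int m | x m. x \<in> {a i - \<epsilon>..a i + \<epsilon>}} =
    (\<Union>z::int. {a i + real (n i) * z - \<epsilon>..a i + real (n i) * z + \<epsilon>})"
    by blast
qed

lemma residue_system_borel [measurable]: "residue_system l \<epsilon> a n \<in> sets borel"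
  unfolding residue_system_eq_UN by (intro sets.finite_UN sets.countable_UN) auto

text \<open>Split \<open>[0, L)\<close> into cells of length \<open>1 / m\<close>. An interval of that length meets every coset of
  \<open>(1 / m) \<int>\<close>, so each fibre over a cell is covered by a discrete residue system.\<close>
lemma emeasure_residue_system_ge:
  fixes m L :: nat
  assumes m: "m > 0" and K: "\<And>c. K \<le> card (covered {1..l} (\<lambda>i. int (m * n i)) c (int (m * L)))"
  shows "emeasure lborel (residue_system l (1 / (2 * real m)) a n \<inter> {0..real L})
           \<ge> ennreal (K / m)"
proof -
  define A where "A = residue_system l (1 / (2 * real m)) a n"
  define T where "T j = A \<inter> {real_of_int j / m..<(real_of_int j + 1) / m}" for j
  have A [measurable]: "A \<in> sets borel" by (simp add: A_def)
  have T: "T j \<in> sets borel" for j by (simp add: T_def)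
  have fibre: "K \<le> card {j \<in> {0..<int (m * L)}. x + j / m \<in> A}" for x :: real
  proof -
    \<comment> \<open>Rounding moves \<open>m * (a i - x)\<close> by at most 1/2, which after
      division by \<open>m\<close> is exactly the half-length of the intervals. The residues depend
      on \<open>x\<close>, so \<open>K\<close> must bound the count for every
      \<open>c\<close>.\<close>
    define c where "c i = round (m * (a i - x))" for i
    have "covered {1..l} (\<lambda>i. int (m * n i)) c (int (m * L)) \<subseteq>
        {j \<in> {0..<int (m * L)}. x + j / m \<in> A}"
    proof
      fix j assume "j \<in> covered {1..l} (\<lambda>i. int (m * n i)) c (int (m * L))"
      then obtain i z where j: "j \<in> {0..<int (m * L)}" "i \<in> {1..l}"
        "j - c i = int (m * n i) * z"
        unfolding covered_def by (blast elim: dvdE)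
      have "\<bar>real_of_int (c i) - m * (a i - x)\<bar> \<le> 1 / 2"
        unfolding c_def by (rule of_int_round_abs_le)
      moreover have "real_of_int j = c i + m * real (n i) * z"
        using arg_cong[OF j(3), of real_of_int] by simp
      then have "real_of_int (c i) - m * (a i - x) = m * (x + j / m - (a i + real (n i) * z))"
        using m by (simp add: field_simps)
      ultimately have "m * \<bar>x + j / m - (a i + real (n i) * z)\<bar> \<le> 1 / 2"
        by (simp add: abs_mult)
      then have "\<bar>x + j / m - (a i + real (n i) * z)\<bar> \<le> 1 / (2 * real m)"
        using m by (simp add: field_simps)
      then have "x + j / m \<in> {a i + real (n i) * z - 1 / (2 * real m)..
          a i + real (n i) * z + 1 / (2 * real m)}"
        unfolding abs_le_iff by auto
      then have "x + j / m \<in> A"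
        unfolding A_def residue_system_eq_UN using j(2) by blast
      with j show "j \<in> {j \<in> {0..<int (m * L)}. x + j / m \<in> A}" by simp
    qed
    then have "card (covered {1..l} (\<lambda>i. int (m * n i)) c (int (m * L))) \<le>
        card {j \<in> {0..<int (m * L)}. x + j / m \<in> A}"
      by (rule card_mono[rotated]) (rule finite_subset[of _ "{0..<int (m * L)}"], auto)
    with K[of c] show ?thesis by linarith
  qed
  have disj: "disjoint_family_on T {0..<int (m * L)}"
  proof (unfold disjoint_family_on_def, intro ballI impI)
    have "\<lfloor>m * x\<rfloor> = j" if "x \<in> T j" for x :: real and j
      by (rule floor_unique) (use that m in \<open>auto simp: T_def field_simps\<close>)
    moreover fix i j :: int assume "i \<noteq> j"
    ultimately show "T i \<inter> T j = {}" by blast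
  qed
  \<comment> \<open>Translating every cell to \<open>{0..<1 / m}\<close> brings the sum over the
    cells under one integral, whose integrand \<open>fibre\<close> bounds pointwise.\<close>
  have T_integral: "emeasure lborel (T j) =
      (\<integral>\<^sup>+x. indicator A (x + j / m) * indicator {0..<1 / real m} x \<partial>lborel)" for j
  proof -
    have "emeasure lborel (T j) = (\<integral>\<^sup>+x. indicator (T j) x \<partial>lborel)"
      by (simp add: T_def)
    also have "\<dots> = (\<integral>\<^sup>+x. indicator (T j) (j / m + 1 * x) \<partial>lborel)"
      by (subst nn_integral_real_affine[of _ 1 "j / m"]) (auto simp: T_def)
    also have "\<dots> = (\<integral>\<^sup>+x. indicator A (x + j / m) * indicator {0..<1 / real m} x \<partial>lborel)"
      by (intro nn_integral_cong) (auto simp: T_def indicator_def add_divide_distrib add.commute)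
    finally show ?thesis .
  qed
  have "ennreal (K / m) = (\<integral>\<^sup>+x. of_nat K * indicator {0..<1 / real m} x \<partial>lborel)"
    using m by (simp add: nn_integral_cmult ennreal_of_nat_eq_real_of_nat ennreal_mult[symmetric])
  also have "\<dots> \<le> (\<integral>\<^sup>+x. (\<Sum>j\<in>{0..<int (m * L)}.
      indicator A (x + j / m) * indicator {0..<1 / real m} x) \<partial>lborel)"
  proof (intro nn_integral_mono)
    fix x :: real
    have "(\<Sum>j\<in>{0..<int (m * L)}. indicator A (x + j / m)) =
        (of_nat (card {j \<in> {0..<int (m * L)}. x + j / m \<in> A}) :: ennreal)"
      by (simp add: indicator_def sum.If_cases Int_def)
    then have "(of_nat K :: ennreal) \<le> (\<Sum>j\<in>{0..<int (m * L)}. indicator A (x + j / m))"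
      using fibre[of x] by simp
    then show "(of_nat K :: ennreal) * indicator {0..<1 / real m} x \<le> (\<Sum>j\<in>{0..<int (m * L)}.
      indicator A (x + j / m) * indicator {0..<1 / real m} x)"
      unfolding sum_distrib_right[symmetric] by (rule mult_right_mono) simp
  qed
  also have "\<dots> = (\<Sum>j\<in>{0..<int (m * L)}. emeasure lborel (T j))"
    unfolding T_integral by (rule nn_integral_sum) measurable
  also have "\<dots> = emeasure lborel (\<Union>j\<in>{0..<int (m * L)}. T j)"
    by (rule sum_emeasure) (use disj T in auto)
  also have "\<dots> \<le> emeasure lborel (A \<inter> {0..real L})"
  proof (rule emeasure_mono)
    show "(\<Union>j\<in>{0..<int (m * L)}. T j) \<subseteq> A \<inter> {0..real L}"
    proof
      fix x assume "x \<in> (\<Union>j\<in>{0..<int (m * L)}. T j)"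
      then obtain j where j: "0 \<le> j" "j + 1 \<le> int (m * L)" "x \<in> T j" by auto
      have "real_of_int (j + 1) \<le> real_of_int (int (m * L))" using j(2) of_int_le_iff by blast
      then have "(real_of_int j + 1) / m \<le> L" using m by (simp add: field_simps)
      moreover have "0 \<le> real_of_int j / m" using j by simp
      ultimately show "x \<in> A \<inter> {0..real L}" using j(3) unfolding T_def by force
    qed
  qed measurable
  finally show ?thesis by (simp add: A_def)
qed

text \<open>The cells around \<open>0\<close> and \<open>L\<close> contribute only half an interval each, whereas
  \<open>covered\<close> counts \<open>0\<close> but not its translate \<open>m * L\<close>.\<close>
lemma emeasure_residue_system_zero_le:
  fixes m L :: nat
  assumes m: "m > 0" and l: "l \<ge> 1" and L: "L > 0"
    and n: "\<And>i. i \<in> {1..l} \<Longrightarrow> n i dvd L"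
  shows "emeasure lborel (residue_system l (1 / (2 * real m)) (\<lambda>_. 0) n \<inter> {0..real L})
     \<le> ennreal (card (covered {1..l} (\<lambda>i. int (m * n i)) (\<lambda>_. 0) (int (m * L))) / m)"
proof -
  define C where "C = covered {1..l} (\<lambda>i. int (m * n i)) (\<lambda>_. 0) (int (m * L))"
  define B where "B j = {(real_of_int j - 1/2) / m..(real_of_int j + 1/2) / m}" for j
  have B: "emeasure lborel (B j) = ennreal (1 / m)" for j
    using m by (simp add: B_def field_simps)
  have C0: "0 \<in> C" using l m L by (auto simp: C_def covered_def)
  have finC: "finite C" by (simp add: C_def)
  have half: "emeasure lborel {0..1/(2*real m)} = ennreal (1 / (2 * m))"
    "emeasure lborel {L - 1/(2*real m)..L} = ennreal (1 / (2 * m))"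
    using m by auto
  have sub: "residue_system l (1 / (2 * real m)) (\<lambda>_. 0) n \<inter> {0..real L} \<subseteq>
      (\<Union>j\<in>C - {0}. B j) \<union> ({0..1/(2*real m)} \<union> {L - 1/(2*real m)..L})"
  proof
    fix x assume x: "x \<in> residue_system l (1 / (2 * real m)) (\<lambda>_. 0) n \<inter> {0..real L}"
    then obtain i and z :: int where i: "i \<in> {1..l}"
      and xz: "real (n i) * z - 1 / (2 * real m) \<le> x" "x \<le> real (n i) * z + 1 / (2 * real m)"
      unfolding residue_system_eq_UN by auto
    define j where "j = int (m * n i) * z"
    have jm: "real (n i) * z = j / m" using m by (simp add: j_def)
    have xj: "x \<in> B j" using xz m unfolding B_def jm by (simp add: field_simps)
    have "0 \<le> x * m" "x * m \<le> real L * m" using x m by auto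
    moreover have "real_of_int j - 1/2 \<le> x * m" "x * m \<le> j + 1/2"
      using xj m by (auto simp: B_def field_simps)
    \<comment> \<open>The bounds are in fact -1/2 and \<open>m * L + 1/2\<close>; integrality leaves
      \<open>0..m * L\<close>. The last value is outside \<open>C\<close> and gives the half
      interval at \<open>L\<close>.\<close>
    ultimately have "- 1 < real_of_int j" "real_of_int j < real_of_int (int (m * L) + 1)"
      by (auto simp: mult.commute)
    then have j: "0 \<le> j" "j \<le> int (m * L)" by linarith+
    consider "j = 0" | "j = int (m * L)" | "j \<in> C - {0}"
      using i j by (force simp: C_def covered_def j_def)
    then show "x \<in> (\<Union>j\<in>C - {0}. B j) \<union> ({0..1/(2*real m)} \<union> {L - 1/(2*real m)..L})"
    proof cases
      case 1
      then show ?thesis using x xz(2) jm by simp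
    next
      case 2
      then have "real (n i) * z = L" using jm m by simp
      then show ?thesis using x xz(1) by auto
    qed (use xj in blast)
  qed
  have "emeasure lborel (residue_system l (1 / (2 * real m)) (\<lambda>_. 0) n \<inter> {0..real L})
    \<le> emeasure lborel ((\<Union>j\<in>C - {0}. B j) \<union> ({0..1/(2*real m)} \<union> {L - 1/(2*real m)..L}))"
    by (rule emeasure_mono[OF sub]) (use finC in \<open>auto simp: B_def\<close>)
  also have "\<dots> \<le> emeasure lborel (\<Union>j\<in>C - {0}. B j) +
      emeasure lborel ({0..1/(2*real m)} \<union> {L - 1/(2*real m)..L})"
    by (rule emeasure_subadditive) (use finC in \<open>auto simp: B_def\<close>)
  also have "\<dots> \<le> (\<Sum>j\<in>C - {0}. emeasure lborel (B j)) +
      (emeasure lborel {0..1/(2*real m)} + emeasure lborel {L - 1/(2*real m)..L})"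
    by (intro add_mono emeasure_subadditive_finite emeasure_subadditive)
       (use finC in \<open>auto simp: B_def\<close>)
  also have "\<dots> = ennreal (real (card (C - {0})) * (1 / m) + (1 / (2 * m) + 1 / (2 * m)))"
    unfolding B half
    by (simp add: ennreal_of_nat_eq_real_of_nat ennreal_mult[symmetric] ennreal_plus[symmetric]
        del: ennreal_plus)
  \<comment> \<open>The two half intervals at the ends together replace the full one that
    \<open>0 \<in> C\<close> would contribute.\<close>
  also have "real (card (C - {0})) * (1 / m) + (1 / (2 * m) + 1 / (2 * m)) = card C / m"
  proof -
    have "card C = Suc (card (C - {0}))" using C0 finC by (metis card.remove)
    then show ?thesis using m by (simp add: field_simps)
  qed
  finally show ?thesis by (simp add: C_def)
qed

theorem theorem1p2:
  fixes l k :: nat and n :: "nat \<Rightarrow> nat" and \<epsilon> :: real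
  assumes "l \<ge> 1"
    and "\<And>i. i \<in> {1..l} \<Longrightarrow> n i \<ge> 1"
    and "k \<ge> 1"
    and "\<epsilon> = 1 / 2 ^ k"
  shows "\<forall>a :: nat \<Rightarrow> real.
    emeasure lebesgue (residue_system l \<epsilon> a n \<inter> {0..real (lcm_tuple l n)})
      \<ge> emeasure lebesgue (residue_system l \<epsilon> (\<lambda>_. 0) n \<inter> {0..real (lcm_tuple l n)})"
proof
  fix a :: "nat \<Rightarrow> real"
  define L where "L = lcm_tuple l n"
  \<comment> \<open>Chosen so that \<open>2 * \<epsilon> = 1 / m\<close>; \<open>k \<ge> 1\<close>
    keeps the subtraction from truncating.\<close>
  define m :: nat where "m = 2 ^ (k - 1)"
  have m: "m > 0" by (simp add: m_def)
  have \<epsilon>: "\<epsilon> = 1 / (2 * real m)"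
    using assms(3,4) by (cases k) (auto simp: m_def)
  have L: "L > 0"
  proof -
    have "0 \<notin> n ` {1..l}" using assms(2) by fastforce
    then have "L \<noteq> 0" by (simp add: L_def lcm_tuple_def Lcm_0_iff)
    then show ?thesis by simp
  qed
  have n: "n i dvd L" if "i \<in> {1..l}" for i
    using that by (simp add: L_def lcm_tuple_def)
  have "card (covered {1..l} (\<lambda>i. int (m * n i)) (\<lambda>_. 0) (int (m * L)))
      \<le> card (covered {1..l} (\<lambda>i. int (m * n i)) c (int (m * L)))" for c
    by (rule rogers_card_covered) (use m L n in auto)
  \<comment> \<open>The count for zero residues serves as \<open>K\<close>: divided by
    \<open>m\<close>, it bounds the zero system from above and the system of \<open>a\<close> from
    below.\<close>
  from order_trans[OF emeasure_residue_system_zero_le[OF m assms(1) L n]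
      emeasure_residue_system_ge[OF m this]]
  show "emeasure lebesgue (residue_system l \<epsilon> a n \<inter> {0..real (lcm_tuple l n)})
      \<ge> emeasure lebesgue (residue_system l \<epsilon> (\<lambda>_. 0) n \<inter> {0..real (lcm_tuple l n)})"
    by (simp add: \<epsilon> L_def)
qed

end
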